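(* Let $A=(f_1,\dots,f_k)$ be a system of tropical polynomials in $n$ variables with finite coefficients, let $V\subset\mathbb{R}^n$ be the tropical prevariety given by $A$, and let $x\in V$ be a generalized vertex of $A$. Then one can choose a multiset of $n$ polynomials from $A$ (one polynomial may be chosen several times) such that $x$ is a stable solution of the tropical system of $n$ polynomials in $n$ variables formed by the chosen polynomials. Moreover, if $k\ge n$, then there are at least $k-n+1$ different multisets of $n$ polynomials from $A$ with this property.
   Context: A tropical polynomial $f$ in $n$ variables is given by a nonempty finite set of tropical monomials $Q_j(x)=a_j+i_{j1}x_1+\cdots+i_{jn}x_n$ with coefficients $a_j\in\mathbb{R}$ and pairwise distinct exponent vectors $(i_{j1},\dots,i_{jn})\in\mathbb{Z}_{\ge 0}^n$; $f(x)=\min_j Q_j(x)$. The tropical degree of $Q_j$ is $i_{j1}+\cdots+i_{jn}$, and the tropical degree of $f$ is the maximum of the degrees of its monomials. A tropical polynomial of tropical degree $e$ has finite coefficients if every monomial of tropical degree at most $e$ occurs in it. A point $x\in\mathbb{R}^n$ is a tropical zero of $f$ if $\min_j Q_j(x)$ is attained for at least two different $j$; a solution of a system is a point of $\mathbb{R}^n$ that is a tropical zero of each of its polynomials, and the tropical prevariety given by the system is the set of its solutions. Multisets of polynomials from $A$ are understood as multisets of indices from $\{1,\dots,k\}$. Star table: the entry $(i,m)$ of $A^{*x}$ (rows: polynomials of $A$; columns: monomials) carries a star if and only if the monomial with exponent vector $m$ occurs in $f_i$ and attains at $x$ the minimal value among all monomials of $f_i$. A point $x$ is a generalized vertex of $A$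 if for every point $y\ne x$ of $\mathbb{R}^n$ the set of starred entries of $A^{*y}$ does not contain that of $A^{*x}$. Stability: let $S$ be a system of $n$ tropical polynomials in $n$ variables, considered as an $n$-tuple (so that repeated polynomials are perturbed independently). A perturbation of $S$ is a system with the same monomials in each polynomial but possibly different (real) coefficients; its amplitude is the maximal absolute difference between corresponding coefficients. A point $x$ is a stable solution of $S$ if there is $\Delta>0$ such that for every $0<\delta<\Delta$ there is $\varepsilon>0$ such that every generic perturbation of $S$ of amplitude at most $\varepsilon$ has at least one solution in the $\delta$-neighbourhood of $x$. Here "generic" means that the coefficient vector of the perturbed system lies outside some finite union of proper affine hyperplanes of the space of coefficient vectors. *)

theory Defs
  imports "HOL-Analysis.Analysis" "HOL-Library.Multiset"
begin

(* A polynomial in the variables indexed by the finite type 'n is the partial map sending the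
   exponent vector of each occurring monomial to its coefficient. *)
type_synonym 'n trop_poly = "(nat ^ 'n) \<rightharpoonup> real"

definition tropical_polynomial :: "'n::finite trop_poly \<Rightarrow> bool" where
  "tropical_polynomial f \<longleftrightarrow> finite (dom f) \<and> dom f \<noteq> {}"

definition monomial_value :: "'n::finite trop_poly \<Rightarrow> nat ^ 'n \<Rightarrow> real ^ 'n \<Rightarrow> real" where
  "monomial_value f m x = the (f m) + (\<Sum>j\<in>UNIV. real (m $ j) * x $ j)"

definition trop_eval :: "'n::finite trop_poly \<Rightarrow> real ^ 'n \<Rightarrow> real" where
  "trop_eval f x = Min ((\<lambda>m. monomial_value f m x) ` dom f)"

definition monomial_degree :: "nat ^ 'n::finite \<Rightarrow> nat" where
  "monomial_degree m = (\<Sum>j\<in>UNIV. m $ j)"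

definition tropical_degree :: "'n::finite trop_poly \<Rightarrow> nat" where
  "tropical_degree f = Max (monomial_degree ` dom f)"

definition finite_coefficients :: "'n::finite trop_poly \<Rightarrow> bool" where
  "finite_coefficients f \<longleftrightarrow> (\<forall>m. monomial_degree m \<le> tropical_degree f \<longrightarrow> m \<in> dom f)"

definition attains_min :: "'n::finite trop_poly \<Rightarrow> real ^ 'n \<Rightarrow> nat ^ 'n \<Rightarrow> bool" where
  "attains_min f x m \<longleftrightarrow> m \<in> dom f \<and> monomial_value f m x = trop_eval f x"

definition tropical_zero :: "'n::finite trop_poly \<Rightarrow> real ^ 'n \<Rightarrow> bool" where
  "tropical_zero f x \<longleftrightarrow> (\<exists>m m'. m \<noteq> m' \<and> attains_min f x m \<and> attains_min f x m')"

(* A system is a list, so repeated polynomials are kept apart and "index" means a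
   position 0, ..., k - 1 in the list. *)
definition prevariety :: "'n::finite trop_poly list \<Rightarrow> (real ^ 'n) set" where
  "prevariety A = {x. \<forall>f\<in>set A. tropical_zero f x}"

definition stars :: "'n::finite trop_poly list \<Rightarrow> real ^ 'n \<Rightarrow> (nat \<times> (nat ^ 'n)) set" where
  "stars A x = {(i, m). i < length A \<and> attains_min (A ! i) x m}"

definition generalized_vertex :: "'n::finite trop_poly list \<Rightarrow> real ^ 'n \<Rightarrow> bool" where
  "generalized_vertex A x \<longleftrightarrow> (\<forall>y. y \<noteq> x \<longrightarrow> \<not> stars A x \<subseteq> stars A y)"

definition coeff_index :: "'n::finite trop_poly list \<Rightarrow> (nat \<times> (nat ^ 'n)) set" where
  "coeff_index S = (SIGMA i:{..<length S}. dom (S ! i))"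

definition coeff_vector :: "'n::finite trop_poly list \<Rightarrow> nat \<times> (nat ^ 'n) \<Rightarrow> real" where
  "coeff_vector S = (\<lambda>(i, m)\<in>coeff_index S. the ((S ! i) m))"

definition perturbation :: "'n::finite trop_poly list \<Rightarrow> 'n trop_poly list \<Rightarrow> bool" where
  "perturbation S T \<longleftrightarrow> length T = length S \<and> (\<forall>i<length S. dom (T ! i) = dom (S ! i))"

definition amplitude :: "'n::finite trop_poly list \<Rightarrow> 'n trop_poly list \<Rightarrow> real" where
  "amplitude S T = Max ((\<lambda>p. \<bar>coeff_vector T p - coeff_vector S p\<bar>) ` coeff_index S)"

definition coeff_hyperplane ::
    "'n::finite trop_poly list \<Rightarrow> (nat \<times> (nat ^ 'n) \<Rightarrow> real) set \<Rightarrow> bool" where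
  "coeff_hyperplane S H \<longleftrightarrow>
     (\<exists>a b. (\<exists>p\<in>coeff_index S. a p \<noteq> 0) \<and>
       H = {c \<in> coeff_index S \<rightarrow>\<^sub>E UNIV. (\<Sum>p\<in>coeff_index S. a p * c p) = b})"

(* The exceptional hyperplanes are chosen before delta and epsilon: one finite union
   \<Union>\<H> must serve for all neighbourhoods of x. *)
definition stable_solution :: "'n::finite trop_poly list \<Rightarrow> real ^ 'n \<Rightarrow> bool" where
  "stable_solution S x \<longleftrightarrow>
     (\<exists>\<H>. finite \<H> \<and> (\<forall>H\<in>\<H>. coeff_hyperplane S H) \<and>
       (\<exists>\<Delta>>0. \<forall>\<delta>. 0 < \<delta> \<and> \<delta> < \<Delta> \<longrightarrow>
         (\<exists>\<epsilon>>0. \<forall>T. perturbation S T \<and> amplitude S T \<le> \<epsilon> \<and> coeff_vector T \<notin> \<Union>\<H>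
            \<longrightarrow> (\<exists>y \<in> ball x \<delta>. y \<in> prevariety T))))"

(* The order in which the chosen polynomials are listed is immaterial for stability. *)
definition subsystem :: "'n::finite trop_poly list \<Rightarrow> nat multiset \<Rightarrow> 'n trop_poly list" where
  "subsystem A M = map (\<lambda>i. A ! i) (sorted_list_of_multiset M)"

definition stable_choices :: "'n::finite trop_poly list \<Rightarrow> real ^ 'n \<Rightarrow> nat multiset set" where
  "stable_choices A x =
     {M. set_mset M \<subseteq> {..<length A} \<and> size M = CARD('n) \<and> stable_solution (subsystem A M) x}"

end

theory Submission
  imports Defs
begin

text \<open>
  At \<open>x\<close> call a monomial of a polynomial active if it attains the minimum there, and call the
  differences of the exponent vectors of two active monomials the edge vectors of that polynomial.
  If some \<open>v \<noteq> 0\<close> were orthogonal to all edge vectors of the system, a short step from \<open>x\<close> in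
  direction \<open>v\<close> would keep every star; so at a generalized vertex the edge vectors span
  \<open>\<real>\<^sup>n\<close> (\<open>generalized_vertex_edge_vectors_span\<close>) and some of them form a basis \<open>B\<close>. Assigning to
  each member of \<open>B\<close> a polynomial of which it is an edge vector yields a multiset of \<open>n\<close>
  polynomials. It is stable (\<open>stable_choice_if_basis\<close>), and it contains at most \<open>n\<close> different
  indices. Every other polynomial \<open>f\<^sub>j\<close> has a nonzero edge vector as well, because \<open>x\<close> is a
  tropical zero of it; exchanging this vector into \<open>B\<close> gives a stable multiset that contains \<open>j\<close>
  and otherwise only indices of the first multiset. These multisets are pairwise different, which
  gives the number \<open>k - n + 1\<close>.

  The core is that \<open>n\<close> polynomials with linearly independent edge vectors \<open>w\<^sub>1, \<dots>, w\<^sub>n\<close> at \<open>x\<close>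
  have \<open>x\<close> as a stable solution. This follows from a global existence theorem,
  \<open>transversal_zero_exists\<close>: if from each of \<open>n\<close> finite sets of exponents one can pick two such
  that the \<open>n\<close> differences are independent, then for all real coefficients the tropical
  polynomials with these exponents have a common zero \<open>z\<close>, and \<open>z\<close> can be chosen
  such that minimising monomials at \<open>z\<close> again have independent differences. It is applied
  to the active monomials with perturbed coefficients. The perturbed values at \<open>x\<close> of active
  monomials of one polynomial differ by at most \<open>2 \<epsilon>\<close>, so \<open>z\<close>, seen as a displacement from \<open>x\<close>,
  solves one of finitely many regular linear systems with a right-hand side of size
  \<open>2 \<epsilon>\<close>. Hence it is small, and the inactive monomials cannot interfere.

  The existence theorem is a tropical maximum principle, proved by induction on the total number
  of monomials. If all polynomials are binomials, it is a linear system. Otherwise remove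
  a superfluous monomial \<open>m\<close> from the \<open>i\<close>-th polynomial and take a transversal zero of the
  remaining system. If \<open>m\<close> undercuts the minimum there, move along the curve cut out by the other
  polynomials and maximise the level, that is the value of \<open>m\<close> minus the minimum of the other
  monomials of the \<open>i\<close>-th polynomial. The maximum under the constraint that the level is \<open>\<le> 0\<close>
  exists, because for each choice of minimising monomials the level determines the point. A maximum
  below \<open>0\<close> is impossible: the induction hypothesis, applied to the homogeneous system of the
  monomials minimising there, provides a direction along the curve in which the level grows
  (\<open>curve_level_increase\<close>). At level \<open>0\<close> the monomial \<open>m\<close> ties with the minimum and a transversal
  zero is found.
\<close>

section \<open>Families of vectors that form a basis\<close>

lemma not_in_span_of_others:
  fixes v :: "'i \<Rightarrow> 'a::euclidean_space"
  assumes "finite I" "card I = DIM('a)" "span (v ` I) = UNIV" "i \<in> I"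
  shows "v i \<notin> span (v ` (I - {i}))"
proof
  assume "v i \<in> span (v ` (I - {i}))"
  moreover have "v ` I = insert (v i) (v ` (I - {i}))"
    using assms(4) by blast
  ultimately have "span (v ` (I - {i})) = UNIV"
    using assms(3) by (simp add: span_redundant)
  then have "DIM('a) \<le> card (v ` (I - {i}))"
    by (metis assms(1) dim_UNIV dim_le_card' dim_span finite_Diff finite_imageI)
  also have "\<dots> \<le> card (I - {i})"
    by (simp add: assms(1) card_image_le)
  also have "\<dots> < DIM('a)"
    using assms by (metis card_Diff1_less)
  finally show False by simp
qed

lemma span_replace:
  fixes v :: "'i \<Rightarrow> 'a::euclidean_space"
  assumes "span (v ` I) = UNIV" "i \<in> I" "w \<notin> span (v ` (I - {i}))"
  shows "span ((v(i := w)) ` I) = UNIV"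
proof -
  have 1: "v ` I = insert (v i) (v ` (I - {i}))"
    using assms(2) by blast
  have 2: "(v(i := w)) ` I = insert w (v ` (I - {i}))"
    using assms(2) by auto
  have "v i \<in> span (insert w (v ` (I - {i})))"
    using assms(1,3) 1 by (metis UNIV_I in_span_insert)
  then have "v ` I \<subseteq> span (insert w (v ` (I - {i})))"
    unfolding 1 using span_superset[of "insert w (v ` (I - {i}))"] by auto
  then have "span (v ` I) \<subseteq> span (insert w (v ` (I - {i})))"
    by (rule span_minimal) simp
  then show ?thesis using assms(1) 2 by auto
qed

lemma orthogonal_to_spanning_zero:
  fixes z :: "'a::euclidean_space"
  assumes "span X = UNIV" "\<And>w. w \<in> X \<Longrightarrow> w \<bullet> z = 0"
  shows "z = 0"
proof -
  have "orthogonal z z"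
  proof (rule orthogonal_to_span[of z X z])
    show "z \<in> span X" using assms(1) by simp
    show "\<And>y. y \<in> X \<Longrightarrow> orthogonal z y"
      by (simp add: orthogonal_def assms(2) inner_commute)
  qed
  then show ?thesis by (simp add: orthogonal_def)
qed

lemma dual_family:
  fixes v :: "'i \<Rightarrow> 'a::euclidean_space"
  assumes "finite I" "card I = DIM('a)" "span (v ` I) = UNIV"
  obtains u where "\<And>i j. i \<in> I \<Longrightarrow> j \<in> I \<Longrightarrow> v j \<bullet> u i = (if i = j then 1 else 0)"
proof -
  have "\<exists>u. \<forall>j\<in>I. v j \<bullet> u = (if i = j then 1 else 0)" if i: "i \<in> I" for i
  proof -
    define X where "X = v ` (I - {i})"
    obtain p q where p: "p \<in> span X" and q: "\<And>w. w \<in> span X \<Longrightarrow> orthogonal q w"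
      and vi: "v i = p + q"
      using orthogonal_subspace_decomp_exists[of X "v i"] by blast
    have "q \<noteq> 0"
      using not_in_span_of_others[OF assms i] p vi X_def by auto
    then have "v i \<bullet> (q /\<^sub>R (q \<bullet> q)) = 1"
      using q[OF p] by (simp add: vi inner_add_left inner_add_right orthogonal_def inner_commute)
    moreover have "v j \<bullet> (q /\<^sub>R (q \<bullet> q)) = 0" if "j \<in> I" "j \<noteq> i" for j
    proof -
      have "v j \<in> span X" using that by (auto simp: X_def intro!: span_base)
      from q[OF this] show ?thesis by (simp add: orthogonal_def inner_commute)
    qed
    ultimately show ?thesis by (metis (full_types))
  qed
  then obtain u where "\<And>i. i \<in> I \<Longrightarrow> \<forall>j\<in>I. v j \<bullet> u i = (if i = j then 1 else 0)"
    by metis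
  then show ?thesis using that by blast
qed

lemma dual_family_expansion:
  fixes v u :: "'i \<Rightarrow> 'a::euclidean_space"
  assumes "finite I" "span (v ` I) = UNIV"
    and u: "\<And>i j. i \<in> I \<Longrightarrow> j \<in> I \<Longrightarrow> v j \<bullet> u i = (if i = j then 1 else 0)"
  shows "z = (\<Sum>i\<in>I. (v i \<bullet> z) *\<^sub>R u i)"
proof -
  have "v j \<bullet> (z - (\<Sum>i\<in>I. (v i \<bullet> z) *\<^sub>R u i)) = 0" if "j \<in> I" for j
  proof -
    have "v j \<bullet> (\<Sum>i\<in>I. (v i \<bullet> z) *\<^sub>R u i) = (\<Sum>i\<in>I. if i = j then v i \<bullet> z else 0)"
      unfolding inner_sum_right by (rule sum.cong) (auto simp: u that)
    then show ?thesis using assms(1) that by (simp add: inner_diff_right)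
  qed
  then have "z - (\<Sum>i\<in>I. (v i \<bullet> z) *\<^sub>R u i) = 0"
    by (intro orthogonal_to_spanning_zero[OF assms(2)]) auto
  then show ?thesis by simp
qed

lemma linear_system_solvable:
  fixes v :: "'i \<Rightarrow> 'a::euclidean_space"
  assumes "finite I" "card I = DIM('a)" "span (v ` I) = UNIV"
  shows "\<exists>y. \<forall>i\<in>I. v i \<bullet> y = r i"
proof -
  obtain u where u: "\<And>i j. i \<in> I \<Longrightarrow> j \<in> I \<Longrightarrow> v j \<bullet> u i = (if i = j then 1 else 0)"
    using dual_family[OF assms] by blast
  have "v j \<bullet> (\<Sum>i\<in>I. r i *\<^sub>R u i) = r j" if "j \<in> I" for j
  proof -
    have "v j \<bullet> (\<Sum>i\<in>I. r i *\<^sub>R u i) = (\<Sum>i\<in>I. if i = j then r i else 0)"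
      unfolding inner_sum_right by (rule sum.cong) (auto simp: u that)
    then show ?thesis using assms(1) that by simp
  qed
  then show ?thesis by blast
qed

lemma linear_system_solution_small:
  fixes v :: "'i \<Rightarrow> 'a::euclidean_space"
  assumes "finite I" "card I = DIM('a)" "span (v ` I) = UNIV" "\<rho> > 0"
  shows "\<forall>\<^sub>F \<epsilon> in at_right 0. \<forall>z. (\<forall>i\<in>I. \<bar>v i \<bullet> z\<bar> \<le> \<epsilon>) \<longrightarrow> norm z < \<rho>"
proof -
  obtain u where u: "\<And>i j. i \<in> I \<Longrightarrow> j \<in> I \<Longrightarrow> v j \<bullet> u i = (if i = j then 1 else 0)"
    using dual_family[OF assms(1-3)] by blast
  define C where "C = (\<Sum>i\<in>I. norm (u i))"
  have bound: "norm z \<le> \<epsilon> * C" if "\<forall>i\<in>I. \<bar>v i \<bullet> z\<bar> \<le> \<epsilon>" for z \<epsilon>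
  proof -
    have "norm z = norm (\<Sum>i\<in>I. (v i \<bullet> z) *\<^sub>R u i)"
      using dual_family_expansion[OF assms(1,3) u, of z] by simp
    also have "\<dots> \<le> (\<Sum>i\<in>I. norm ((v i \<bullet> z) *\<^sub>R u i))"
      by (rule norm_sum)
    also have "\<dots> \<le> (\<Sum>i\<in>I. \<epsilon> * norm (u i))"
      using that by (intro sum_mono) (simp add: mult_right_mono)
    finally show ?thesis by (simp add: C_def sum_distrib_left)
  qed
  have "((\<lambda>\<epsilon>. \<epsilon> * C) \<longlongrightarrow> 0 * C) (at_right 0)"
    by (intro tendsto_intros)
  then have "\<forall>\<^sub>F \<epsilon> in at_right 0. \<epsilon> * C < \<rho>"
    using assms(4) by (auto intro: order_tendstoD)
  then show ?thesis
    by eventually_elim (use bound in fastforce)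
qed


section \<open>Minimising monomials\<close>

definition minimisers :: "'m set \<Rightarrow> ('m \<Rightarrow> real) \<Rightarrow> 'm set" where
  "minimisers S g = {m \<in> S. \<forall>m'\<in>S. g m \<le> g m'}"

lemma minimisersD:
  assumes "m \<in> minimisers S g"
  shows "m \<in> S" "m' \<in> S \<Longrightarrow> g m \<le> g m'"
  using assms by (auto simp: minimisers_def)

lemma minimisers_eq: "m \<in> minimisers S g \<Longrightarrow> m' \<in> minimisers S g \<Longrightarrow> g m = g m'"
  by (auto simp: minimisers_def intro: antisym)

lemma minimisers_nonempty:
  assumes "finite S" "S \<noteq> {}"
  shows "minimisers S g \<noteq> {}"
proof -
  obtain m where "m \<in> S" "\<forall>m'\<in>S. g m \<le> g m'"
    using assms by (metis arg_min_if_finite(1) arg_min_least)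
  then show ?thesis by (auto simp: minimisers_def)
qed

text \<open>To first order, moving from a point in direction \<open>u\<close> selects those minimising monomials on
  which \<open>u\<close> is smallest; finiteness turns this into a statement about short genuine steps.\<close>

lemma minimisers_short_step:
  fixes e :: "'m \<Rightarrow> 'a::real_inner"
  assumes fin: "finite S"
    and p: "p \<in> minimisers (minimisers S (\<lambda>m. c m + e m \<bullet> y)) (\<lambda>m. e m \<bullet> u)"
  shows "\<forall>\<^sub>F s in at_right 0. p \<in> minimisers S (\<lambda>m. c m + e m \<bullet> (y + s *\<^sub>R u))"
proof -
  let ?g = "\<lambda>m. c m + e m \<bullet> y"
  have pS: "p \<in> minimisers S ?g" using p by (rule minimisersD)
  have "\<forall>\<^sub>F s in at_right 0. c p + e p \<bullet> (y + s *\<^sub>R u) \<le> c m + e m \<bullet> (y + s *\<^sub>R u)"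
    if m: "m \<in> S" for m
  proof (cases "m \<in> minimisers S ?g")
    case True
    then have "e p \<bullet> u \<le> e m \<bullet> u" using p by (auto simp: minimisers_def)
    moreover have "?g p = ?g m" using minimisers_eq[OF pS True] .
    ultimately have "c p + e p \<bullet> (y + s *\<^sub>R u) \<le> c m + e m \<bullet> (y + s *\<^sub>R u)" if "s > 0" for s
      using that by (simp add: inner_add_right) (smt (verit) mult_left_mono)
    then show ?thesis
      by (auto intro: eventually_mono[OF eventually_at_right_less])
  next
    case False
    then have "?g p < ?g m"
      using m pS by (force simp: minimisers_def)
    moreover have "((\<lambda>s. (c m + e m \<bullet> (y + s *\<^sub>R u)) - (c p + e p \<bullet> (y + s *\<^sub>R u)))
        \<longlongrightarrow> (c m + e m \<bullet> (y + 0 *\<^sub>R u)) - (c p + e p \<bullet> (y + 0 *\<^sub>R u))) (at_right 0)"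
      by (intro tendsto_intros)
    ultimately have "\<forall>\<^sub>F s in at_right 0.
        0 < (c m + e m \<bullet> (y + s *\<^sub>R u)) - (c p + e p \<bullet> (y + s *\<^sub>R u))"
      by (intro order_tendstoD(1)) auto
    then show ?thesis by eventually_elim simp
  qed
  then have "\<forall>\<^sub>F s in at_right 0.
      \<forall>m\<in>S. c p + e p \<bullet> (y + s *\<^sub>R u) \<le> c m + e m \<bullet> (y + s *\<^sub>R u)"
    using fin by (simp add: eventually_ball_finite)
  then show ?thesis
    by eventually_elim (use pS in \<open>auto simp: minimisers_def\<close>)
qed


section \<open>Existence of transversal zeros for arbitrary coefficients\<close>

text \<open>The map \<open>e\<close> gives the exponent vectors; the \<open>i\<close>-th polynomial has the monomials \<open>S i\<close> with
  coefficients \<open>c i\<close>. At a transversal zero the ties between \<open>a i\<close> and \<open>b i\<close> form a linear system; when it has as many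
  equations as there are dimensions, the spanning condition makes the zero its only solution.\<close>

definition transversal_zero ::
    "'i set \<Rightarrow> ('m \<Rightarrow> 'a::euclidean_space) \<Rightarrow> ('i \<Rightarrow> 'm set) \<Rightarrow> ('i \<Rightarrow> 'm \<Rightarrow> real) \<Rightarrow> 'a \<Rightarrow>
      ('i \<Rightarrow> 'm) \<Rightarrow> ('i \<Rightarrow> 'm) \<Rightarrow> bool" where
  "transversal_zero I e S c y a b \<longleftrightarrow>
     (\<forall>i\<in>I. a i \<in> minimisers (S i) (\<lambda>m. c i m + e m \<bullet> y) \<and>
            b i \<in> minimisers (S i) (\<lambda>m. c i m + e m \<bullet> y)) \<and>
     span ((\<lambda>i. e (a i) - e (b i)) ` I) = UNIV"

text \<open>The polynomials other than the \<open>i\<close>-th cut out a curve. Its points are considered together with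
  the level \<open>t\<close> by which \<open>m\<close> exceeds the minimum of the other monomials of the \<open>i\<close>-th polynomial.
  The spanning condition makes the level strictly monotone along the branch of the curve
  given by \<open>a\<close> and \<open>b\<close>.\<close>

definition curve_point ::
    "'i set \<Rightarrow> ('m \<Rightarrow> 'a::euclidean_space) \<Rightarrow> ('i \<Rightarrow> 'm set) \<Rightarrow> ('i \<Rightarrow> 'm \<Rightarrow> real) \<Rightarrow> 'i \<Rightarrow> 'm \<Rightarrow>
      real \<Rightarrow> 'a \<Rightarrow> ('i \<Rightarrow> 'm) \<Rightarrow> ('i \<Rightarrow> 'm) \<Rightarrow> bool" where
  "curve_point I e S c i m t y a b \<longleftrightarrow>
     (\<forall>j\<in>I - {i}. a j \<in> minimisers (S j) (\<lambda>m. c j m + e m \<bullet> y) \<and>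
                 b j \<in> minimisers (S j) (\<lambda>m. c j m + e m \<bullet> y)) \<and>
     a i = m \<and> b i \<in> minimisers (S i - {m}) (\<lambda>m. c i m + e m \<bullet> y) \<and>
     (c i m + e m \<bullet> y) - (c i (b i) + e (b i) \<bullet> y) = t \<and>
     span ((\<lambda>i. e (a i) - e (b i)) ` I) = UNIV"

text \<open>For fixed pairs of minimising monomials the curve runs inside a line, on which the level is an
  affine coordinate: the point is an affine function of \<open>t\<close>, and being a curve point is
  described by equations and weak inequalities between continuous functions of \<open>t\<close>.\<close>

lemma closed_curve_levels_of_type:
  fixes e :: "'m \<Rightarrow> 'a::euclidean_space"
  assumes I: "finite I" "card I = DIM('a)" "i \<in> I"
  shows "closed {t. \<exists>y. curve_point I e S c i m t y a b}"
proof (cases "\<exists>t1 y1. curve_point I e S c i m t1 y1 a b")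
  case True
  then obtain t1 y1 where 1: "curve_point I e S c i m t1 y1 a b" by blast
  define v where "v = (\<lambda>i. e (a i) - e (b i))"
  have sp: "span (v ` I) = UNIV" using 1 by (simp add: curve_point_def v_def)
  obtain w where w: "\<And>i j. i \<in> I \<Longrightarrow> j \<in> I \<Longrightarrow> v j \<bullet> w i = (if i = j then 1 else 0)"
    using dual_family[OF I(1,2) sp] by blast
  define u where "u = w i"
  have u: "v i \<bullet> u = 1" "\<And>j. j \<in> I \<Longrightarrow> j \<noteq> i \<Longrightarrow> v j \<bullet> u = 0"
    using w I by (auto simp: u_def)
  have on_line: "y = y1 + (t - t1) *\<^sub>R u" if 2: "curve_point I e S c i m t y a b" for t y
  proof -
    have "v j \<bullet> (y - (y1 + (t - t1) *\<^sub>R u)) = 0" if j: "j \<in> I" for j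
    proof (cases "j = i")
      case True
      have "v i \<bullet> y - v i \<bullet> y1 = t - t1"
        using 1 2 by (auto simp: curve_point_def v_def inner_diff_left)
      then show ?thesis using True u(1) by (simp add: inner_diff_right inner_add_right)
    next
      case False
      then have "c j (a j) + e (a j) \<bullet> y = c j (b j) + e (b j) \<bullet> y"
          "c j (a j) + e (a j) \<bullet> y1 = c j (b j) + e (b j) \<bullet> y1"
        using 1 2 j by (auto simp: curve_point_def intro!: minimisers_eq[where S = "S j"])
      then show ?thesis using u(2)[OF j False]
        by (simp add: inner_diff_right inner_add_right) (simp add: v_def inner_diff_left)
    qed
    then have "y - (y1 + (t - t1) *\<^sub>R u) = 0"
      by (intro orthogonal_to_spanning_zero[OF sp]) auto
    then show ?thesis by simp
  qed
  have "{t. \<exists>y. curve_point I e S c i m t y a b} =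
      {t. curve_point I e S c i m t (y1 + (t - t1) *\<^sub>R u) a b}"
    using on_line by auto
  also have "closed \<dots>"
    unfolding curve_point_def minimisers_def mem_Collect_eq Ball_def
    by (intro closed_Collect_conj closed_Collect_all closed_Collect_imp closed_Collect_const
        closed_Collect_le closed_Collect_eq open_Collect_const continuous_intros)
  finally show ?thesis .
next
  case False
  then show ?thesis by simp
qed

text \<open>Only the values of \<open>a\<close> and \<open>b\<close> on \<open>I\<close> matter, so there are finitely many types of curve points.\<close>

lemma closed_curve_levels:
  fixes e :: "'m \<Rightarrow> 'a::euclidean_space"
  assumes I: "finite I" "card I = DIM('a)" "i \<in> I"
    and S: "\<And>j. j \<in> I \<Longrightarrow> finite (S j)" and m: "m \<in> S i"
  shows "closed {t. \<exists>y a b. curve_point I e S c i m t y a b}"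
proof -
  define F where "F = (\<Pi>\<^sub>E j\<in>I. S j)"
  have "finite F" unfolding F_def using I(1) S by (rule finite_PiE)
  have "curve_point I e S c i m t y (restrict a I) (restrict b I) \<and>
      restrict a I \<in> F \<and> restrict b I \<in> F"
    if "curve_point I e S c i m t y a b" for t y a b
  proof -
    have "(\<lambda>i. e (restrict a I i) - e (restrict b I i)) ` I = (\<lambda>i. e (a i) - e (b i)) ` I"
      by (rule image_cong) auto
    moreover have "a j \<in> S j \<and> b j \<in> S j" if "j \<in> I" for j
      using \<open>curve_point I e S c i m t y a b\<close> that m
      by (cases "j = i") (auto simp: curve_point_def minimisers_def)
    ultimately show ?thesis
      using that I(3) by (auto simp: curve_point_def F_def)
  qed
  then have "{t. \<exists>y a b. curve_point I e S c i m t y a b} =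
      (\<Union>(a, b)\<in>F \<times> F. {t. \<exists>y. curve_point I e S c i m t y a b})"
    by auto blast
  also have "closed \<dots>"
    using \<open>finite F\<close> closed_curve_levels_of_type[OF I] by (intro closed_UN) auto
  finally show ?thesis .
qed

text \<open>No curve point at a negative level is a local maximum of the level. Near the point only the
  minimising monomials matter, so directions \<open>u\<close> along the curve are zeros of the homogeneous
  system that they form. Demanding in addition that \<open>m\<close> gains \<open>1\<close> on \<open>b i\<close> is one more
  binomial equation, which turns the search for \<open>u\<close> into a transversal zero problem
  of the same kind whose \<open>i\<close>-th polynomial is a binomial. If another minimiser of the original
  \<open>i\<close>-th polynomial takes over from \<open>b i\<close> along \<open>u\<close>, it grows more slowly than \<open>b i\<close>, so the level
  increases even faster.\<close>

lemma curve_level_increase: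
  fixes e :: "'m \<Rightarrow> 'a::euclidean_space"
  assumes I: "finite I" "card I = DIM('a)" "i \<in> I"
    and S: "\<And>j. j \<in> I \<Longrightarrow> finite (S j)"
    and 1: "curve_point I e S c i m t y a b" and t: "t < 0"
    and smaller: "\<And>S' c'. S' i = {m, b i} \<Longrightarrow>
        (\<And>j. j \<in> I - {i} \<Longrightarrow> S' j \<subseteq> S j \<and> a j \<in> S' j \<and> b j \<in> S' j) \<Longrightarrow>
        \<exists>y a b. transversal_zero I e S' c' y a b"
  shows "\<exists>t'>t. t' \<le> 0 \<and> (\<exists>y a b. curve_point I e S c i m t' y a b)"
proof -
  let ?g = "\<lambda>j m. c j m + e m \<bullet> y"
  define S' where "S' = (\<lambda>j. minimisers (S j) (?g j))(i := {m, b i})"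
  \<comment> \<open>With the coefficient \<open>-1\<close> at \<open>m\<close>, a tie of \<open>m\<close> and \<open>b i\<close> at \<open>u\<close> says that \<open>m\<close> gains \<open>1\<close>.\<close>
  define c' where "c' = (\<lambda>j p. if j = i \<and> p = m then -1 else (0::real))"
  have "a j \<in> S' j \<and> b j \<in> S' j" if "j \<in> I - {i}" for j
    using 1 that by (auto simp: curve_point_def S'_def)
  then have "\<exists>y a b. transversal_zero I e S' c' y a b"
    by (intro smaller) (auto simp: S'_def minimisers_def)
  then obtain u a2 b2 where tz: "transversal_zero I e S' c' u a2 b2" by blast
  define v where "v = (\<lambda>j. e (a2 j) - e (b2 j))"
  have sp: "span (v ` I) = UNIV" using tz by (simp add: transversal_zero_def v_def)
  have mb: "m \<noteq> b i" using 1 by (auto simp: curve_point_def minimisers_def)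
  have "v i \<noteq> 0"
    using not_in_span_of_others[OF I(1,2) sp I(3)] span_0 by metis
  then have "a2 i \<noteq> b2 i" by (auto simp: v_def)
  moreover have ab2: "a2 i \<in> minimisers (S' i) (\<lambda>p. c' i p + e p \<bullet> u)"
      "b2 i \<in> minimisers (S' i) (\<lambda>p. c' i p + e p \<bullet> u)"
    using tz I(3) by (auto simp: transversal_zero_def)
  moreover have "a2 i \<in> {m, b i}" "b2 i \<in> {m, b i}"
    using ab2 by (auto simp: S'_def minimisers_def)
  ultimately have "m \<in> minimisers (S' i) (\<lambda>p. c' i p + e p \<bullet> u)"
      "b i \<in> minimisers (S' i) (\<lambda>p. c' i p + e p \<bullet> u)"
    by auto
  from minimisers_eq[OF this] mb have mu: "e m \<bullet> u - e (b i) \<bullet> u = 1"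
    by (simp add: c'_def)
  have ab2j: "a2 j \<in> minimisers (minimisers (S j) (?g j)) (\<lambda>p. e p \<bullet> u)"
       "b2 j \<in> minimisers (minimisers (S j) (?g j)) (\<lambda>p. e p \<bullet> u)" if "j \<in> I - {i}" for j
    using tz that by (auto simp: transversal_zero_def S'_def c'_def)
  define R where "R = S i - {m}"
  have bi: "b i \<in> minimisers R (?g i)" using 1 by (simp add: curve_point_def R_def)
  have "finite R" using S I(3) by (simp add: R_def)
  then have "finite (minimisers R (?g i))" by (auto simp: minimisers_def)
  \<comment> \<open>\<open>b i\<close> may be overtaken as soon as the point moves; \<open>q\<close> is a monomial that stays minimal.\<close>
  then obtain q where q: "q \<in> minimisers (minimisers R (?g i)) (\<lambda>p. e p \<bullet> u)"
    using minimisers_nonempty bi by (metis all_not_in_conv)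
  define r where "r = e m \<bullet> u - e q \<bullet> u"
  have "e q \<bullet> u \<le> e (b i) \<bullet> u" using q bi by (auto simp: minimisers_def)
  then have r: "r \<ge> 1" using mu by (simp add: r_def)
  \<comment> \<open>The direction \<open>u\<close> is orthogonal to all other differences but not to this one.\<close>
  have "e m - e q \<notin> span (v ` (I - {i}))"
  proof
    assume "e m - e q \<in> span (v ` (I - {i}))"
    then have "orthogonal u (e m - e q)"
    proof (rule orthogonal_to_span)
      fix x assume "x \<in> v ` (I - {i})"
      then obtain j where "j \<in> I - {i}" "x = v j" by blast
      then show "orthogonal u x"
        using minimisers_eq[OF ab2j] by (simp add: orthogonal_def v_def inner_commute[of u] inner_diff_left)
    qed
    then show False using r by (simp add: orthogonal_def r_def inner_commute[of u] inner_diff_left)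
  qed
  from span_replace[OF sp I(3) this]
  have sp3: "span ((v(i := e m - e q)) ` I) = UNIV" .
  define a3 where "a3 = a2(i := m)"
  define b3 where "b3 = b2(i := q)"
  have v3: "v(i := e m - e q) = (\<lambda>j. e (a3 j) - e (b3 j))"
    by (auto simp: v_def a3_def b3_def)
  have "\<forall>\<^sub>F s in at_right 0. \<forall>j\<in>I - {i}.
      a2 j \<in> minimisers (S j) (\<lambda>p. c j p + e p \<bullet> (y + s *\<^sub>R u)) \<and>
      b2 j \<in> minimisers (S j) (\<lambda>p. c j p + e p \<bullet> (y + s *\<^sub>R u))"
    using I(1) S ab2j
    by (intro eventually_ball_finite ballI eventually_conj minimisers_short_step) auto
  moreover have "\<forall>\<^sub>F s in at_right 0. q \<in> minimisers R (\<lambda>p. c i p + e p \<bullet> (y + s *\<^sub>R u))"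
    using \<open>finite R\<close> q by (rule minimisers_short_step)
  moreover have "\<forall>\<^sub>F s in at_right 0. t + s * r < 0"
  proof -
    have "((\<lambda>s. t + s * r) \<longlongrightarrow> t + 0 * r) (at_right 0)" by (intro tendsto_intros)
    then show ?thesis using t by (intro order_tendstoD(2)) auto
  qed
  moreover have "\<forall>\<^sub>F s in at_right 0. (0::real) < s"
    by (rule eventually_at_right_less)
  ultimately have step: "\<forall>\<^sub>F s in at_right 0. t < t + s * r \<and> t + s * r \<le> 0 \<and>
      curve_point I e S c i m (t + s * r) (y + s *\<^sub>R u) a3 b3"
  proof eventually_elim
    case (elim s)
    have "?g i q = ?g i (b i)"
      using q bi by (intro minimisers_eq[where S = R]) (auto simp: minimisers_def)
    then have "(c i m + e m \<bullet> (y + s *\<^sub>R u)) - (c i q + e q \<bullet> (y + s *\<^sub>R u)) = t + s * r"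
      using 1 by (simp add: curve_point_def r_def inner_add_right algebra_simps)
    then have "curve_point I e S c i m (t + s * r) (y + s *\<^sub>R u) a3 b3"
      using elim sp3 unfolding v3 by (auto simp: curve_point_def a3_def b3_def R_def)
    then show ?case using elim r by simp
  qed
  show ?thesis
    using eventually_happens'[OF trivial_limit_at_right_real step] by blast
qed

theorem transversal_zero_exists:
  fixes e :: "'m \<Rightarrow> 'a::euclidean_space"
  assumes I: "finite I" "card I = DIM('a)"
    and "\<And>i. i \<in> I \<Longrightarrow> finite (S i)"
    and "\<And>i. i \<in> I \<Longrightarrow> a i \<in> S i \<and> b i \<in> S i"
    and "span ((\<lambda>i. e (a i) - e (b i)) ` I) = UNIV"
  shows "\<exists>y a b. transversal_zero I e S c y a b"
  using assms(3-5)
proof (induction "\<Sum>i\<in>I. card (S i)" arbitrary: S c a b rule: less_induct)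
  case less
  let ?v = "\<lambda>i. e (a i) - e (b i)"
  note fin = less.prems(1) and ab = less.prems(2) and sp = less.prems(3)
  show ?case
  proof (cases "\<exists>i\<in>I. \<exists>m\<in>S i. m \<noteq> a i \<and> m \<noteq> b i")
    case False
    obtain y where y: "\<forall>i\<in>I. ?v i \<bullet> y = c i (b i) - c i (a i)"
      using linear_system_solvable[OF I sp, of "\<lambda>i. c i (b i) - c i (a i)"] by blast
    have "c i (a i) + e (a i) \<bullet> y = c i (b i) + e (b i) \<bullet> y" if "i \<in> I" for i
      using bspec[OF y that] by (simp add: inner_diff_left)
    moreover have "m = a i \<or> m = b i" if "i \<in> I" "m \<in> S i" for i m
      using False that by blast
    ultimately have "transversal_zero I e S c y a b"
      unfolding transversal_zero_def minimisers_def using ab sp by (smt (verit) mem_Collect_eq)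
    then show ?thesis by blast
  next
    case True
    then obtain i m where i: "i \<in> I" and m: "m \<in> S i" "m \<noteq> a i" "m \<noteq> b i" by blast
    have "?v i \<noteq> 0"
      using not_in_span_of_others[OF I sp i] span_0 by metis
    then have "a i \<noteq> b i" by auto
    have "\<exists>y a b. transversal_zero I e (S(i := S i - {m})) c y a b"
    proof (rule less.hyps)
      show "(\<Sum>j\<in>I. card ((S(i := S i - {m})) j)) < (\<Sum>j\<in>I. card (S j))"
        using I(1) i m(1) fin 
        by (intro sum_strict_mono_ex1)
          (auto simp del: card_Diff_singleton card_Diff_insert intro!: bexI[of _ i] card_Diff1_less card_mono)
    qed (use fin ab sp m in \<open>auto split: if_splits\<close>)
    then obtain y1 a1 b1 where tz1: "transversal_zero I e (S(i := S i - {m})) c y1 a1 b1"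
      by blast
    let ?g1 = "\<lambda>j p. c j p + e p \<bullet> y1"
    have a1i: "a1 i \<in> minimisers (S i - {m}) (?g1 i)" and b1i: "b1 i \<in> minimisers (S i - {m}) (?g1 i)"
      using tz1 i by (auto simp: transversal_zero_def)
    show ?thesis
    proof (cases "?g1 i m < ?g1 i (a1 i)")
      case False
      have "?g1 i (b1 i) = ?g1 i (a1 i)" using minimisers_eq[OF b1i a1i] .
      then have "a1 i \<in> minimisers (S i) (?g1 i)" "b1 i \<in> minimisers (S i) (?g1 i)"
        using a1i b1i False by (auto simp: minimisers_def)
      then have "transversal_zero I e S c y1 a1 b1"
        using tz1 by (auto simp: transversal_zero_def split: if_splits)
      then show ?thesis by blast
    next
      case True
      define K where "K = {t. \<exists>y a b. curve_point I e S c i m t y a b}"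
      have "\<exists>t1<0. t1 \<in> K"
      proof -
        let ?v1 = "\<lambda>j. e (a1 j) - e (b1 j)"
        have sp1: "span (?v1 ` I) = UNIV" using tz1 by (simp add: transversal_zero_def)
        \<comment> \<open>At least one of the two tied monomials, paired with \<open>m\<close>, keeps the vectors independent.\<close>
        have "?v1 i \<notin> span (?v1 ` (I - {i}))"
          using not_in_span_of_others[OF I sp1 i] .
        moreover have "?v1 i = (e m - e (b1 i)) - (e m - e (a1 i))" by simp
        ultimately have "e m - e (a1 i) \<notin> span (?v1 ` (I - {i})) \<or>
            e m - e (b1 i) \<notin> span (?v1 ` (I - {i}))"
          by (metis span_diff)
        then obtain p where p: "p = a1 i \<or> p = b1 i" "e m - e p \<notin> span (?v1 ` (I - {i}))"
          by blast
        have "?v1(i := e m - e p) = (\<lambda>j. e ((a1(i := m)) j) - e ((b1(i := p)) j))"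
          by auto
        then have "span ((\<lambda>j. e ((a1(i := m)) j) - e ((b1(i := p)) j)) ` I) = UNIV"
          using span_replace[OF sp1 i p(2)] by simp
        then have "curve_point I e S c i m (?g1 i m - ?g1 i p) y1 (a1(i := m)) (b1(i := p))"
          using tz1 p(1) a1i b1i by (auto simp: curve_point_def transversal_zero_def)
        moreover have "?g1 i m - ?g1 i p < 0"
          using p(1) True minimisers_eq[OF a1i b1i] by auto
        ultimately show ?thesis unfolding K_def by blast
      qed
      then obtain t1 where t1: "t1 < 0" "t1 \<in> K" by blast
      have "closed K"
        unfolding K_def using closed_curve_levels[of I i S m e c] I i fin m(1) by blast
      then have "compact (K \<inter> {t1..0})"
        by (simp add: closed_Int_compact)
      moreover have "K \<inter> {t1..0} \<noteq> {}" using t1 by auto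
      ultimately obtain t where "t \<in> K \<inter> {t1..0}"
          and "\<forall>t'\<in>K \<inter> {t1..0}. t' \<le> t"
        by (metis compact_attains_sup)
      then have t: "t \<in> K" "t1 \<le> t" "t \<le> 0"
        and max: "\<And>t'. t' \<in> K \<Longrightarrow> t1 \<le> t' \<Longrightarrow> t' \<le> 0 \<Longrightarrow> t' \<le> t"
        by auto
      obtain y a3 b3 where cp: "curve_point I e S c i m t y a3 b3"
        using t(1) by (auto simp: K_def)
      have "t = 0"
      proof (rule ccontr)
        assume "t \<noteq> 0"
        then have "t < 0" using t by simp
        have "\<exists>t'>t. t' \<le> 0 \<and> (\<exists>y a b. curve_point I e S c i m t' y a b)"
        proof (rule curve_level_increase[OF I i fin cp \<open>t < 0\<close>])
          fix S' :: "'b \<Rightarrow> 'm set" and c'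
          assume S': "S' i = {m, b3 i}"
            "\<And>j. j \<in> I - {i} \<Longrightarrow> S' j \<subseteq> S j \<and> a3 j \<in> S' j \<and> b3 j \<in> S' j"
          have finS': "finite (S' j)" if j: "j \<in> I" for j
          proof (cases "j = i")
            case False
            then show ?thesis using S'(2)[of j] fin[OF j] j finite_subset by auto
          qed (simp add: S'(1))
          show "\<exists>y a b. transversal_zero I e S' c' y a b"
          proof (rule less.hyps)
            have "card (S' i) < card {m, a i, b i}"
              using S'(1) m \<open>a i \<noteq> b i\<close> by (simp add: card_insert_if)
            also have "\<dots> \<le> card (S i)"
              using fin i m ab by (intro card_mono) auto
            finally have "card (S' i) < card (S i)" .
            moreover have "card (S' j) \<le> card (S j)" if "j \<in> I" for j
              using calculation S'(2)[of j] fin that by (cases "j = i") (auto intro: card_mono)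
            ultimately show "(\<Sum>j\<in>I. card (S' j)) < (\<Sum>j\<in>I. card (S j))"
              using I(1) i by (intro sum_strict_mono_ex1) auto
            show "span ((\<lambda>j. e (a3 j) - e (b3 j)) ` I) = UNIV"
              using cp by (simp add: curve_point_def)
            show "a3 j \<in> S' j \<and> b3 j \<in> S' j" if "j \<in> I" for j
              using S' cp that by (cases "j = i") (auto simp: curve_point_def)
          qed (rule finS')
        qed
        then show False using max t unfolding K_def by fastforce
      qed
      have "a3 i \<in> minimisers (S i) (\<lambda>p. c i p + e p \<bullet> y) \<and>
          b3 i \<in> minimisers (S i) (\<lambda>p. c i p + e p \<bullet> y)"
        using cp \<open>t = 0\<close> m(1) by (auto simp: curve_point_def minimisers_def)
      then have "transversal_zero I e S c y a3 b3"
        using cp by (auto simp: curve_point_def transversal_zero_def)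
      then show ?thesis by blast
    qed
  qed
qed


section \<open>Local behaviour of tropical polynomials\<close>

definition exponent :: "nat ^ 'n::finite \<Rightarrow> real ^ 'n" where
  "exponent m = (\<chi> j. real (m $ j))"

definition edge_vectors :: "'n::finite trop_poly \<Rightarrow> real ^ 'n \<Rightarrow> (real ^ 'n) set" where
  "edge_vectors f x = {exponent m - exponent m' |m m'. attains_min f x m \<and> attains_min f x m'}"

lemma monomial_value_add:
  "monomial_value f m (x + z) = monomial_value f m x + exponent m \<bullet> z"
  unfolding monomial_value_def exponent_def inner_vec_def
  by (simp add: distrib_left sum.distrib)

lemma attains_min_iff_minimiser:
  assumes "finite (dom f)"
  shows "attains_min f x m \<longleftrightarrow> m \<in> minimisers (dom f) (\<lambda>m. monomial_value f m x)"
proof -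
  have "monomial_value f m x = trop_eval f x \<longleftrightarrow>
      (\<forall>m'\<in>dom f. monomial_value f m x \<le> monomial_value f m' x)" if "m \<in> dom f"
    unfolding trop_eval_def eq_commute[of "monomial_value f m x"] using assms that
    by (subst Min_eq_iff) auto
  then show ?thesis by (auto simp: attains_min_def minimisers_def)
qed

lemma finite_attains_min: "finite (dom f) \<Longrightarrow> finite {m. attains_min f x m}"
  by (rule finite_subset[of _ "dom f"]) (auto simp: attains_min_def)

text \<open>Inactive monomials exceed the minimum at \<open>x\<close> by a positive gap, so they stay irrelevant at
  nearby points and for nearby coefficients: the active monomials compete only among themselves.\<close>

lemma minimal_among_active_attains_min:
  fixes f :: "'n::finite trop_poly"
  assumes f: "tropical_polynomial f"
  shows "\<forall>\<^sub>F \<eta> in at_right 0. \<forall>g z. dom g = dom f \<longrightarrow>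
      (\<forall>m\<in>dom f. \<bar>the (g m) - the (f m)\<bar> \<le> \<eta>) \<longrightarrow> norm z \<le> \<eta> \<longrightarrow>
      minimisers {m. attains_min f x m} (\<lambda>m. monomial_value g m (x + z))
        \<subseteq> {m. attains_min g (x + z) m}"
proof -
  have fin: "finite (dom f)" using f by (simp add: tropical_polynomial_def)
  let ?F = "{m. attains_min f x m}"
  have "\<forall>\<^sub>F \<eta> in at_right 0.
      monomial_value f p x + 2 * \<eta> + norm (exponent p - exponent m) * \<eta> < monomial_value f m x"
    if "p \<in> ?F" "m \<in> dom f - ?F" for p m
  proof -
    have "((\<lambda>\<eta>. monomial_value f p x + 2 * \<eta> + norm (exponent p - exponent m) * \<eta>) \<longlongrightarrow>
        monomial_value f p x + 2 * 0 + norm (exponent p - exponent m) * 0) (at_right 0)"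
      by (intro tendsto_intros)
    moreover have "monomial_value f p x < monomial_value f m x"
      using that fin by (force simp: attains_min_iff_minimiser minimisers_def)
    ultimately show ?thesis by (intro order_tendstoD(2)) auto
  qed
  then have "\<forall>\<^sub>F \<eta> in at_right 0. \<forall>p\<in>?F. \<forall>m\<in>dom f - ?F.
      monomial_value f p x + 2 * \<eta> + norm (exponent p - exponent m) * \<eta> < monomial_value f m x"
    using fin finite_attains_min[OF fin] by (intro eventually_ball_finite ballI) auto
  then show ?thesis
  proof eventually_elim
    case (elim \<eta>)
    show ?case
    proof (intro allI impI subsetI CollectI)
      fix g z p
      assume dom: "dom g = dom f" and g: "\<forall>m\<in>dom f. \<bar>the (g m) - the (f m)\<bar> \<le> \<eta>"
        and z: "norm z \<le> \<eta>" and p: "p \<in> minimisers ?F (\<lambda>m. monomial_value g m (x + z))"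
      have pF: "p \<in> ?F" and pdom: "p \<in> dom f"
        using p by (auto simp: minimisers_def attains_min_def)
      have diff: "\<bar>monomial_value g m x - monomial_value f m x\<bar> \<le> \<eta>" if "m \<in> dom f" for m
        using g that by (simp add: monomial_value_def)
      have "monomial_value g p (x + z) \<le> monomial_value g m (x + z)" if m: "m \<in> dom f" for m
      proof (cases "m \<in> ?F")
        case True
        then show ?thesis using p by (auto simp: minimisers_def)
      next
        case False
        have "\<bar>(exponent p - exponent m) \<bullet> z\<bar> \<le> norm (exponent p - exponent m) * norm z"
          by (rule Cauchy_Schwarz_ineq2)
        also have "\<dots> \<le> norm (exponent p - exponent m) * \<eta>"
          using z by (simp add: mult_left_mono)
        finally have "exponent p \<bullet> z - exponent m \<bullet> z \<le> norm (exponent p - exponent m) * \<eta>"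
          by (simp add: inner_diff_left)
        moreover have "monomial_value f p x + 2 * \<eta> + norm (exponent p - exponent m) * \<eta>
            < monomial_value f m x"
          using elim pF m False by blast
        ultimately show ?thesis
          using diff[OF pdom] diff[OF m] by (simp add: monomial_value_add)
      qed
      then show "attains_min g (x + z) p"
        using fin pdom by (simp add: attains_min_iff_minimiser dom minimisers_def)
    qed
  qed
qed

text \<open>Moving orthogonally to all edge vectors changes all active monomials of a polynomial by the same
  amount, so for a short move they all remain minimal and no star is lost.\<close>

lemma generalized_vertex_edge_vectors_span:
  fixes A :: "'n::finite trop_poly list"
  assumes A: "\<forall>f\<in>set A. tropical_polynomial f" and vertex: "generalized_vertex A x"
  shows "span (\<Union>f\<in>set A. edge_vectors f x) = UNIV"
proof (rule ccontr)
  assume "span (\<Union>f\<in>set A. edge_vectors f x) \<noteq> UNIV"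
  then obtain v where v: "v \<noteq> 0" "\<forall>w\<in>span (\<Union>f\<in>set A. edge_vectors f x). v \<bullet> w = 0"
    using span_not_UNIV_orthogonal by blast
  have "\<forall>\<^sub>F s in at_right 0. attains_min f (x + s *\<^sub>R v) m"
    if f: "f \<in> set A" and m: "attains_min f x m" for f m
  proof -
    let ?h = "\<lambda>m. monomial_value f m x"
    have fin: "finite (dom f)" using A f by (simp add: tropical_polynomial_def)
    have "exponent m \<bullet> v \<le> exponent m' \<bullet> v" if "attains_min f x m'" for m'
    proof -
      have "exponent m - exponent m' \<in> (\<Union>f\<in>set A. edge_vectors f x)"
        using f m that by (auto simp: edge_vectors_def)
      then have "v \<bullet> (exponent m - exponent m') = 0" using bspec[OF v(2) span_base] by simp
      then show ?thesis by (simp add: inner_diff_right inner_commute[of v])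
    qed
    then have "m \<in> minimisers (minimisers (dom f) ?h) (\<lambda>m. exponent m \<bullet> v)"
      using m unfolding attains_min_iff_minimiser[OF fin]
      by (simp add: minimisers_def[of "minimisers (dom f) ?h"])
    then have "\<forall>\<^sub>F s in at_right 0.
        m \<in> minimisers (dom f) (\<lambda>m. ?h m + exponent m \<bullet> (0 + s *\<^sub>R v))"
      by (intro minimisers_short_step fin) simp
    then show ?thesis
      using fin by (simp add: attains_min_iff_minimiser monomial_value_add)
  qed
  then have "\<forall>\<^sub>F s in at_right 0. \<forall>f\<in>set A. \<forall>m\<in>{m. attains_min f x m}.
      attains_min f (x + s *\<^sub>R v) m"
    using A by (intro eventually_ball_finite ballI finite_attains_min)
      (auto simp: tropical_polynomial_def)
  then have "\<forall>\<^sub>F s in at_right 0. stars A x \<subseteq> stars A (x + s *\<^sub>R v) \<and> 0 < s"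
    using eventually_at_right_less[of "0::real"]
    by eventually_elim (auto simp: stars_def)
  then obtain s where "stars A x \<subseteq> stars A (x + s *\<^sub>R v)" "0 < s"
    using eventually_happens'[OF trivial_limit_at_right_real] by blast
  moreover have "x + s *\<^sub>R v \<noteq> x" using v(1) \<open>0 < s\<close> by simp
  ultimately show False using vertex by (auto simp: generalized_vertex_def)
qed


section \<open>Stability\<close>

lemma perturbation_coeff_le_amplitude:
  fixes S T :: "'n::finite trop_poly list"
  assumes S: "\<forall>f\<in>set S. tropical_polynomial f" and T: "perturbation S T"
    and i: "i < length S" "m \<in> dom (S ! i)"
  shows "\<bar>the ((T ! i) m) - the ((S ! i) m)\<bar> \<le> amplitude S T"
proof -
  have "finite (coeff_index S)"
    using S by (auto simp: coeff_index_def tropical_polynomial_def)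
  moreover have im: "(i, m) \<in> coeff_index S" "(i, m) \<in> coeff_index T"
    using T i by (auto simp: coeff_index_def perturbation_def)
  ultimately have "\<bar>coeff_vector T (i, m) - coeff_vector S (i, m)\<bar> \<le> amplitude S T"
    unfolding amplitude_def by (intro Max_ge) auto
  then show ?thesis using im by (simp add: coeff_vector_def)
qed

text \<open>Apply the existence theorem to the active monomials, with the perturbed values at \<open>x\<close> as
  coefficients. The zero \<open>z\<close> that it yields depends on the perturbation, and so does the pair of
  minimising monomials in each polynomial; but there are finitely many such pairs, hence
  one \<open>\<epsilon>\<close> makes \<open>z\<close> small in all cases.\<close>

lemma stable_solution_if_transversal:
  fixes S :: "'n::finite trop_poly list"
  assumes len: "length S = CARD('n)" and S: "\<forall>f\<in>set S. tropical_polynomial f"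
    and w: "\<And>p. p < length S \<Longrightarrow> w p \<in> edge_vectors (S ! p) x"
    and sp: "span (w ` {..<length S}) = UNIV"
  shows "stable_solution S x"
proof -
  define I where "I = {..<length S}"
  have I: "finite I" "card I = DIM(real ^ 'n)" by (simp_all add: I_def len)
  have "\<exists>m m'. attains_min (S ! p) x m \<and> attains_min (S ! p) x m' \<and>
      w p = exponent m - exponent m'" if "p \<in> I" for p
    using w[of p] that by (auto simp: edge_vectors_def I_def)
  then obtain a b where ab: "\<And>p. p \<in> I \<Longrightarrow> attains_min (S ! p) x (a p) \<and>
      attains_min (S ! p) x (b p) \<and> w p = exponent (a p) - exponent (b p)"
    by metis
  define F where "F = (\<lambda>p. {m. attains_min (S ! p) x m})"
  have tp: "tropical_polynomial (S ! p)" if "p \<in> I" for p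
    using S that by (auto simp: I_def)
  have finF: "finite (F p)" if "p \<in> I" for p
    using tp[OF that] by (simp add: F_def finite_attains_min tropical_polynomial_def)
  define v where
    "v = (\<lambda>(a' :: nat \<Rightarrow> nat ^ 'n, b') p :: nat. exponent (a' p) - exponent (b' p))"
  define P where "P = PiE I F \<times> PiE I F"
  have finP: "finite P" unfolding P_def using I(1) finF by (intro finite_cartesian_product finite_PiE)
  have "\<exists>\<epsilon>>0. \<forall>T. perturbation S T \<and> amplitude S T \<le> \<epsilon> \<longrightarrow> (\<exists>y\<in>ball x \<delta>. y \<in> prevariety T)"
    if \<delta>: "\<delta> > 0" for \<delta>
  proof -
    let ?near = "\<lambda>\<rho> p. \<forall>g z. dom g = dom (S ! p) \<longrightarrow>
        (\<forall>m\<in>dom (S ! p). \<bar>the (g m) - the ((S ! p) m)\<bar> \<le> \<rho>) \<longrightarrow> norm z \<le> \<rho> \<longrightarrow>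
        minimisers (F p) (\<lambda>m. monomial_value g m (x + z)) \<subseteq> {m. attains_min g (x + z) m}"
    have "\<forall>\<^sub>F \<rho> in at_right 0. (\<forall>p\<in>I. ?near \<rho> p) \<and> 0 < \<rho>"
      unfolding F_def
      by (intro eventually_conj eventually_ball_finite ballI I(1) eventually_at_right_less
          minimal_among_active_attains_min tp)
    then obtain \<rho> where \<rho>: "\<forall>p\<in>I. ?near \<rho> p" "0 < \<rho>"
      using eventually_happens'[OF trivial_limit_at_right_real] by blast
    have "\<forall>\<^sub>F \<epsilon> in at_right 0. \<forall>q\<in>P. span (v q ` I) = UNIV \<longrightarrow>
        (\<forall>z. (\<forall>p\<in>I. \<bar>v q p \<bullet> z\<bar> \<le> \<epsilon>) \<longrightarrow> norm z < min \<rho> \<delta>)"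
      using finP
    proof (intro eventually_ball_finite ballI)
      fix q
      show "\<forall>\<^sub>F \<epsilon> in at_right 0. span (v q ` I) = UNIV \<longrightarrow>
          (\<forall>z. (\<forall>p\<in>I. \<bar>v q p \<bullet> z\<bar> \<le> \<epsilon>) \<longrightarrow> norm z < min \<rho> \<delta>)"
        using linear_system_solution_small[OF I, of "v q" "min \<rho> \<delta>"] \<delta> \<rho>(2)
        by (cases "span (v q ` I) = UNIV") auto
    qed
    then have "\<forall>\<^sub>F \<epsilon> in at_right 0. (\<forall>q\<in>P. span (v q ` I) = UNIV \<longrightarrow>
        (\<forall>z. (\<forall>p\<in>I. \<bar>v q p \<bullet> z\<bar> \<le> \<epsilon>) \<longrightarrow> norm z < min \<rho> \<delta>)) \<and> 0 < \<epsilon>"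
      by (intro eventually_conj eventually_at_right_less)
    from eventually_happens'[OF trivial_limit_at_right_real this]
    obtain \<epsilon> where \<epsilon>: "\<And>q z. q \<in> P \<Longrightarrow> span (v q ` I) = UNIV \<Longrightarrow>
        \<forall>p\<in>I. \<bar>v q p \<bullet> z\<bar> \<le> \<epsilon> \<Longrightarrow> norm z < min \<rho> \<delta>" "0 < \<epsilon>"
      by blast
    have "\<exists>y\<in>ball x \<delta>. y \<in> prevariety T"
      if T: "perturbation S T" and amp: "amplitude S T \<le> min \<rho> (\<epsilon> / 2)" for T
    proof -
      have coeff: "\<bar>the ((T ! p) m) - the ((S ! p) m)\<bar> \<le> min \<rho> (\<epsilon> / 2)"
        if "p \<in> I" "m \<in> dom (S ! p)" for p m
        using perturbation_coeff_le_amplitude[OF S T _ that(2)] amp that(1) by (force simp: I_def)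
      let ?c = "\<lambda>p m. monomial_value (T ! p) m x"
      have "\<exists>z a b. transversal_zero I exponent F ?c z a b"
      proof (rule transversal_zero_exists[OF I finF])
        show "\<And>p. p \<in> I \<Longrightarrow> a p \<in> F p \<and> b p \<in> F p" using ab by (simp add: F_def)
        have "w ` I = (\<lambda>p. exponent (a p) - exponent (b p)) ` I"
          using ab by (intro image_cong) auto
        then show "span ((\<lambda>p. exponent (a p) - exponent (b p)) ` I) = UNIV"
          using sp by (simp add: I_def)
      qed
      then obtain z a' b' where tz: "transversal_zero I exponent F ?c z a' b'" by blast
      define q where "q = (restrict a' I, restrict b' I)"
      have vq: "v q p = exponent (a' p) - exponent (b' p)" if "p \<in> I" for p
        using that by (simp add: v_def q_def)
      then have "v q ` I = (\<lambda>p. exponent (a' p) - exponent (b' p)) ` I"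
        by (intro image_cong) auto
      then have spq: "span (v q ` I) = UNIV" using tz by (simp add: transversal_zero_def)
      have min: "a' p \<in> minimisers (F p) (\<lambda>m. ?c p m + exponent m \<bullet> z)"
          "b' p \<in> minimisers (F p) (\<lambda>m. ?c p m + exponent m \<bullet> z)" if "p \<in> I" for p
        using tz that by (auto simp: transversal_zero_def)
      note inF = minimisersD(1)[OF min(1)] minimisersD(1)[OF min(2)]
      have "q \<in> P" using inF by (auto simp: q_def P_def)
      moreover have "\<bar>v q p \<bullet> z\<bar> \<le> \<epsilon>" if p: "p \<in> I" for p
      proof -
        have "\<bar>?c p m - trop_eval (S ! p) x\<bar> \<le> \<epsilon> / 2" if "m \<in> F p" for m
        proof -
          have "m \<in> dom (S ! p)" "monomial_value (S ! p) m x = trop_eval (S ! p) x"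
            using that by (auto simp: F_def attains_min_def)
          moreover have "\<bar>the ((T ! p) m) - the ((S ! p) m)\<bar> \<le> \<epsilon> / 2"
            using coeff[OF p \<open>m \<in> dom (S ! p)\<close>] by simp
          ultimately show ?thesis unfolding monomial_value_def by linarith
        qed
        from this[OF inF(1)[OF p]] this[OF inF(2)[OF p]] minimisers_eq[OF min[OF p]]
        show ?thesis unfolding vq[OF p] inner_diff_left by linarith
      qed
      ultimately have z: "norm z < min \<rho> \<delta>" using \<epsilon>(1) spq by blast
      have "tropical_zero (T ! p) (x + z)" if p: "p \<in> I" for p
      proof -
        have "minimisers (F p) (\<lambda>m. monomial_value (T ! p) m (x + z))
            \<subseteq> {m. attains_min (T ! p) (x + z) m}"
          using \<rho>(1) p coeff[OF p] z T by (auto simp: perturbation_def I_def)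
        then have "attains_min (T ! p) (x + z) (a' p)" "attains_min (T ! p) (x + z) (b' p)"
          using min[OF p] by (auto simp: monomial_value_add)
        moreover have "v q p \<noteq> 0"
          using not_in_span_of_others[OF I spq p] span_0 by metis
        then have "a' p \<noteq> b' p" by (auto simp: vq[OF p])
        ultimately show ?thesis by (auto simp: tropical_zero_def)
      qed
      then have "x + z \<in> prevariety T"
        using T by (auto simp: prevariety_def perturbation_def I_def in_set_conv_nth)
      moreover have "x + z \<in> ball x \<delta>" using z by (simp add: dist_norm)
      ultimately show ?thesis by blast
    qed
    then show ?thesis using \<rho>(2) \<epsilon>(2) by (intro exI[of _ "min \<rho> (\<epsilon> / 2)"]) auto
  qed
  then show ?thesis
    unfolding stable_solution_def by (intro exI[of _ "{}"] conjI exI[of _ 1]) auto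
qed


section \<open>Choosing the polynomials\<close>

text \<open>Stability refers to the list of chosen polynomials sorted by index, so the basis has to be
  enumerated in the order of the indices assigned to its members.\<close>

lemma stable_choice_if_basis:
  fixes A :: "'n::finite trop_poly list"
  assumes A: "\<forall>f\<in>set A. tropical_polynomial f"
    and B: "independent B" "span B = UNIV"
    and idx: "\<And>w. w \<in> B \<Longrightarrow> idx w < length A \<and> w \<in> edge_vectors (A ! idx w) x"
  shows "image_mset idx (mset_set B) \<in> stable_choices A x"
proof -
  have fin: "finite B" using B(1) by (rule independent_imp_finite)
  have card: "card B = CARD('n)"
    using dim_eq_card_independent[OF B(1)] dim_span[of B] B(2) by simp
  obtain bs0 where bs0: "set bs0 = B" "distinct bs0"
    using finite_distinct_list[OF fin] by blast
  define bs where "bs = sort_key idx bs0"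
  have bs: "set bs = B" "length bs = CARD('n)"
    using bs0 card by (auto simp: bs_def distinct_card)
  have M: "image_mset idx (mset_set B) = mset (map idx bs0)"
    using bs0 by (metis mset_map mset_set_set)
  have "sorted_list_of_multiset (image_mset idx (mset_set B)) = sort (map idx bs0)"
    unfolding M by (rule sorted_list_of_multiset_mset)
  also have "\<dots> = map idx bs"
    unfolding bs_def by (rule properties_for_sort) simp_all
  finally have sub: "subsystem A (image_mset idx (mset_set B)) = map (\<lambda>w. A ! idx w) bs"
    by (simp add: subsystem_def)
  have "stable_solution (map (\<lambda>w. A ! idx w) bs) x"
  proof (rule stable_solution_if_transversal[where w = "\<lambda>p. bs ! p"])
    show "\<forall>f\<in>set (map (\<lambda>w. A ! idx w) bs). tropical_polynomial f"
      using A idx bs(1) by auto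
    show "span ((!) bs ` {..<length (map (\<lambda>w. A ! idx w) bs)}) = UNIV"
    proof -
      have "(!) bs ` {..<length bs} = B" using bs(1) by (auto simp: set_conv_nth)
      then show ?thesis using B(2) by simp
    qed
  qed (use bs idx in \<open>auto simp: nth_mem\<close>)
  then show ?thesis
    using fin card idx by (auto simp: stable_choices_def sub)
qed

lemma finite_stable_choices: "finite (stable_choices A (x :: real ^ 'n::finite))"
proof (rule finite_surj)
  show "finite {xs. set xs \<subseteq> {..<length A} \<and> length xs = CARD('n)}"
    by (rule finite_lists_length_eq) simp
  show "stable_choices A x \<subseteq> mset ` {xs. set xs \<subseteq> {..<length A} \<and> length xs = CARD('n)}"
  proof
    fix M assume M: "M \<in> stable_choices A x"
    obtain xs where "M = mset xs" using ex_mset by metis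
    then show "M \<in> mset ` {xs. set xs \<subseteq> {..<length A} \<and> length xs = CARD('n)}"
      using M by (auto simp: stable_choices_def)
  qed
qed

theorem theorem6p2:
  fixes A :: "'n::finite trop_poly list" and x :: "real ^ 'n"
  assumes "\<forall>f\<in>set A. tropical_polynomial f"
    and "\<forall>f\<in>set A. finite_coefficients f"
    and "x \<in> prevariety A"
    and "generalized_vertex A x"
  shows "(\<exists>M. M \<in> stable_choices A x) \<and>
    (CARD('n) \<le> length A \<longrightarrow> length A - CARD('n) + 1 \<le> card (stable_choices A x))"
proof -
  let ?V = "\<Union>f\<in>set A. edge_vectors f x"
  obtain B where B: "B \<subseteq> ?V" "independent B" "?V \<subseteq> span B"
    using maximal_independent_subset by blast
  have spB: "span B = UNIV"
    using generalized_vertex_edge_vectors_span[OF assms(1,4)] B(3)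
    by (metis span_minimal subspace_span top.extremum_uniqueI)
  have "\<exists>i<length A. w \<in> edge_vectors (A ! i) x" if "w \<in> B" for w
    using that B(1) by (fastforce simp: in_set_conv_nth)
  then obtain idx where idx: "\<And>w. w \<in> B \<Longrightarrow> idx w < length A \<and> w \<in> edge_vectors (A ! idx w) x"
    by metis
  define M where "M = image_mset idx (mset_set B)"
  have finB: "finite B" using B(2) by (rule independent_imp_finite)
  have M: "M \<in> stable_choices A x"
    unfolding M_def by (rule stable_choice_if_basis[OF assms(1) B(2) spB idx])
  define J where "J = {..<length A} - idx ` B"
  have "\<exists>N\<in>stable_choices A x. j \<in># N \<and> set_mset N \<subseteq> insert j (idx ` B)" if j: "j \<in> J" for j
  proof -
    have "tropical_zero (A ! j) x"
      using assms(3) j by (auto simp: prevariety_def J_def)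
    then obtain m m' where m: "m \<noteq> m'" "attains_min (A ! j) x m" "attains_min (A ! j) x m'"
      by (auto simp: tropical_zero_def)
    define u where "u = exponent m - exponent m'"
    have u: "u \<in> edge_vectors (A ! j) x" using m by (auto simp: u_def edge_vectors_def)
    have "u \<noteq> 0" using m(1) by (auto simp: u_def exponent_def vec_eq_iff)
    then have "independent {u}" by simp
    then obtain B' where B': "{u} \<subseteq> B'" "B' \<subseteq> insert u B" "independent B'" "insert u B \<subseteq> span B'"
      using maximal_independent_subset_extend[of "{u}" "insert u B"] by blast
    have "span B \<subseteq> span B'"
      using B'(4) by (intro span_minimal) auto
    then have spB': "span B' = UNIV" using spB by auto
    \<comment> \<open>\<open>u\<close> may already belong to \<open>B\<close>, with another index; then only its index changes.\<close>
    have "image_mset (idx(u := j)) (mset_set B') \<in> stable_choices A x"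
      by (rule stable_choice_if_basis[OF assms(1) B'(3) spB'])
        (use idx B'(2) u j in \<open>auto simp: J_def\<close>)
    moreover have "finite B'" using B'(3) by (rule independent_imp_finite)
    ultimately show ?thesis
      using B'(1,2) by (intro bexI[of _ "image_mset (idx(u := j)) (mset_set B')"]) auto
  qed
  then obtain N where N: "\<And>j. j \<in> J \<Longrightarrow> N j \<in> stable_choices A x \<and> j \<in># N j \<and>
      set_mset (N j) \<subseteq> insert j (idx ` B)"
    by metis
  have "inj_on N J"
  proof (rule inj_onI)
    fix j j' assume "j \<in> J" "j' \<in> J" "N j = N j'"
    then have "j \<in> insert j' (idx ` B)" using N[of j] N[of j'] by auto
    then show "j = j'" using \<open>j \<in> J\<close> by (simp add: J_def)
  qed
  have "set_mset M = idx ` B" using finB by (simp add: M_def)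
  then have "M \<notin> N ` J" using N by (auto simp: J_def)
  then have "card J + 1 = card (insert M (N ` J))"
    using \<open>inj_on N J\<close> by (simp add: J_def card_image)
  also have "\<dots> \<le> card (stable_choices A x)"
    using M N by (intro card_mono finite_stable_choices) auto
  finally have "card J + 1 \<le> card (stable_choices A x)" .
  moreover have "length A - CARD('n) \<le> card J"
  proof -
    have "size M = CARD('n)" using M by (simp add: stable_choices_def)
    then have "card (idx ` B) \<le> CARD('n)"
      using card_image_le[OF finB, of idx] by (simp add: M_def)
    moreover have "length A - card (idx ` B) \<le> card J"
      unfolding J_def using diff_card_le_card_Diff[of "idx ` B" "{..<length A}"] finB by simp
    ultimately show ?thesis by linarith
  qed
  ultimately show ?thesis using M by (auto intro: order_trans[rotated])
qed

end
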